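(* Let $\ell$ and $n$ be integers with $\ell\geq 1$ and $n> e^{\ell+2}$. Then $\pi_l(G_{n,\ell})>\ell$.
   Context: $G_{n,\ell}$ is the graph with vertex set $\{v_{2i-1}: i\in[n]\}\cup\{v_{2i}^j : i\in[n],\ j\in[\binom{\ell n}{\ell}]\}$, where two vertices are adjacent if and only if their lower indices differ by exactly $1$ (i.e. it is obtained from a path on $2n$ vertices by replacing every second vertex by an independent set of $\binom{\ell n}{\ell}$ vertices). Here $[m]=\{1,\dots,m\}$. A vertex coloring $\phi$ of a graph $G$ is nonrepetitive if there is no path (with no repeated vertices) $u_1\ldots u_{2r}$, $r\geq1$, with $\phi(u_i)=\phi(u_{r+i})$ for all $i\in[r]$. The Thue choice number $\pi_l(G)$ is the minimum $\ell$ such that for every assignment of lists $L_v$ with $|L_v|\geq\ell$ for all $v\in V(G)$ there is a nonrepetitive coloring $\phi$ of $G$ with $\phi(v)\in L_v$ for all $v$. *)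

theory Defs
  imports Complex_Main "Graph_Theory.Graph_Theory"
begin

text \<open>A vertex colouring only matters on the vertices of the graph. A path is a vertex sequence
  without repetitions (\<^const>\<open>vpath\<close>), and positions are counted from 0.\<close>

definition nonrepetitive :: "('v, 'e) pre_digraph \<Rightarrow> ('v \<Rightarrow> 'c) \<Rightarrow> bool" where
  "nonrepetitive G \<phi> \<longleftrightarrow>
     \<not> (\<exists>u r. r \<ge> 1 \<and> vpath u G \<and> length u = 2 * r \<and>
          (\<forall>i<r. \<phi> (u ! i) = \<phi> (u ! (r + i))))"

text \<open>Lists are finite sets of colours. Only finitely many colours occur in the lists of a finite
  graph, so natural numbers suffice as colours.\<close>

definition nonrepetitively_choosable :: "('v, 'e) pre_digraph \<Rightarrow> nat \<Rightarrow> bool" where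
  "nonrepetitively_choosable G k \<longleftrightarrow>
     (\<forall>L :: 'v \<Rightarrow> nat set. (\<forall>v \<in> verts G. finite (L v) \<and> card (L v) \<ge> k) \<longrightarrow>
        (\<exists>\<phi>. nonrepetitive G \<phi> \<and> (\<forall>v \<in> verts G. \<phi> v \<in> L v)))"

definition thue_choice_number :: "('v, 'e) pre_digraph \<Rightarrow> nat" where
  "thue_choice_number G = (LEAST k. nonrepetitively_choosable G k)"

text \<open>\<open>Single k\<close> stands for $v_k$ ($k$ odd) and \<open>Multi k j\<close> for $v_k^j$ ($k$ even).\<close>

datatype vertex = Single (lower_index: nat) | Multi (lower_index: nat) nat

definition G_verts :: "nat \<Rightarrow> nat \<Rightarrow> vertex set" where
  "G_verts n l = {Single (2 * i - 1) | i. i \<in> {1..n}} \<union>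
     {Multi (2 * i) j | i j. i \<in> {1..n} \<and> j \<in> {1..(l * n) choose l}}"

definition G_graph :: "nat \<Rightarrow> nat \<Rightarrow> vertex pair_pre_digraph" where
  "G_graph n l = \<lparr> pverts = G_verts n l,
     parcs = {(u, v). u \<in> G_verts n l \<and> v \<in> G_verts n l \<and>
                \<bar>int (lower_index u) - int (lower_index v)\<bar> = 1} \<rparr>"

lemma finite_G_verts: "finite (G_verts n l)"
proof -
  have "G_verts n l = (\<lambda>i. Single (2 * i - 1)) ` {1..n} \<union>
      (\<lambda>(i, j). Multi (2 * i) j) ` ({1..n} \<times> {1..(l * n) choose l})"
    unfolding G_verts_def by auto
  then show ?thesis by simp
qed

text \<open>Undirected simple graphs are represented by symmetric loop-free pair digraphs.\<close>

lemma pair_graph_G_graph: "pair_graph (G_graph n l)"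
proof
  show "finite (pverts (G_graph n l))" by (simp add: G_graph_def finite_G_verts)
  have "parcs (G_graph n l) \<subseteq> G_verts n l \<times> G_verts n l" by (auto simp: G_graph_def)
  then show "finite (parcs (G_graph n l))"
    by (rule finite_subset) (simp add: finite_G_verts)
  have "sym (parcs (G_graph n l))"
    by (rule symI) (simp add: G_graph_def abs_minus_commute)
  then show "symmetric (with_proj (G_graph n l))"
    by (simp add: symmetric_def)
next
  fix e assume "e \<in> parcs (G_graph n l)"
  then show "fst e \<in> pverts (G_graph n l)" "snd e \<in> pverts (G_graph n l)" "fst e \<noteq> snd e"
    by (auto simp: G_graph_def)
qed

text \<open>On a finite graph the minimum in \<^const>\<open>thue_choice_number\<close> is attained: lists with as many
  colours as there are vertices admit an injective choice.\<close>

lemma injective_choice: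
  assumes "finite A" "\<And>v. v \<in> A \<Longrightarrow> finite (L v) \<and> card (L v) \<ge> card A"
  shows "\<exists>\<phi>. inj_on \<phi> A \<and> (\<forall>v\<in>A. \<phi> v \<in> L v)"
  using assms
proof (induction A rule: finite_induct)
  case empty
  then show ?case by simp
next
  case (insert x A)
  have "finite (L v) \<and> card (L v) \<ge> card A" if "v \<in> A" for v
    using insert.prems[of v] that insert.hyps by auto
  then obtain \<phi> where \<phi>: "inj_on \<phi> A" "\<forall>v\<in>A. \<phi> v \<in> L v" using insert.IH by blast
  have "card (\<phi> ` A) < card (L x)"
    using insert.prems[of x] insert.hyps card_image_le[of A \<phi>] by auto
  then have "\<not> L x \<subseteq> \<phi> ` A"
    using card_mono[of "\<phi> ` A" "L x"] insert.hyps by auto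
  then obtain c where c: "c \<in> L x" "c \<notin> \<phi> ` A" by auto
  have "inj_on (\<phi>(x := c)) (insert x A)" "\<forall>v\<in>insert x A. (\<phi>(x := c)) v \<in> L v"
    using \<phi> c insert.hyps by (auto simp: inj_on_def)
  then show ?case by blast
qed

lemma nonrepetitive_if_inj_on:
  assumes "inj_on \<phi> (verts G)"
  shows "nonrepetitive G \<phi>"
  unfolding nonrepetitive_def
proof (intro notI, elim exE conjE)
  fix u and r :: nat
  assume r: "r \<ge> 1" and u: "vpath u G" "length u = 2 * r"
    and eq: "\<forall>i<r. \<phi> (u ! i) = \<phi> (u ! (r + i))"
  have sub: "set u \<subseteq> verts G" and dist: "distinct u"
    using u(1) by (auto simp: vpath_def vwalk_def)
  have "u ! 0 \<in> verts G" "u ! r \<in> verts G" using sub r u(2) by auto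
  moreover have "\<phi> (u ! 0) = \<phi> (u ! r)" using eq[rule_format, of 0] r by simp
  ultimately have "u ! 0 = u ! r" using assms by (auto dest: inj_onD)
  then show False using dist r u(2) nth_eq_iff_index_eq[of u 0 r] by auto
qed

lemma nonrepetitively_choosable_card_verts:
  assumes "finite (verts G)"
  shows "nonrepetitively_choosable G (card (verts G))"
  unfolding nonrepetitively_choosable_def
proof (intro allI impI)
  fix L :: "'a \<Rightarrow> nat set"
  assume "\<forall>v\<in>verts G. finite (L v) \<and> card (verts G) \<le> card (L v)"
  then have "\<exists>\<phi>. inj_on \<phi> (verts G) \<and> (\<forall>v\<in>verts G. \<phi> v \<in> L v)"
    by (intro injective_choice assms) simp
  then obtain \<phi> where "inj_on \<phi> (verts G)" and \<phi>: "\<forall>v\<in>verts G. \<phi> v \<in> L v"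
    by (elim exE conjE)
  from this(1) have "nonrepetitive G \<phi>" by (rule nonrepetitive_if_inj_on)
  with \<phi> show "\<exists>\<phi>. nonrepetitive G \<phi> \<and> (\<forall>v\<in>verts G. \<phi> v \<in> L v)" by (intro exI conjI)
qed

end

theory Submission
  imports Defs
begin

text \<open>If, in a window of \<open>2 * r\<close> consecutive indices, any two layers at distance \<open>r\<close> share a colour,
  then the window carries a repetition. Hence in a nonrepetitive colouring every such window
  contains two layers at distance \<open>r\<close> with disjoint palettes, and there are at least
  \<open>2 * n div r - 1\<close> pairs of this kind. Summing over the odd \<open>r < n\<close> yields at least \<open>n * ln n - n\<close>
  disjoint pairs of one even and one odd layer.

  Give the \<open>n\<close> vertices of odd index pairwise disjoint lists covering \<open>{..<l * n}\<close>, and let the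
  copies at each even index carry all \<open>l\<close>-subsets of \<open>{..<l * n}\<close> as lists. Then every even palette
  misses fewer than \<open>l\<close> colours and so is disjoint from fewer than \<open>l\<close> odd palettes. The
  number of disjoint pairs is therefore at most \<open>n * (l - 1)\<close>, which forces \<open>ln n \<le> l\<close>.\<close>

section \<open>Repetitions along layers\<close>

lemma vwalk_map_upt:
  assumes "a < b"
    and "\<And>x. a \<le> x \<Longrightarrow> x < b \<Longrightarrow> f x \<in> verts G"
    and "\<And>x. a \<le> x \<Longrightarrow> Suc x < b \<Longrightarrow> (f x, f (Suc x)) \<in> arcs_ends G"
  shows "vwalk (map f [a..<b]) G"
  using assms
proof (induction b)
  case 0
  then show ?case by simp
next
  case (Suc b)
  show ?case
  proof (cases "a = b")
    case True
    then show ?thesis using Suc.prems by (simp add: vwalk_def)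
  next
    case False
    then have "a < b" using Suc.prems(1) by simp
    then have "vwalk (map f [a..<b]) G" using Suc by simp
    moreover have "(last (map f [a..<b]), f b) \<in> arcs_ends G"
      using \<open>a < b\<close> Suc.prems(3)[of "b - 1"] by (simp add: last_map)
    ultimately show ?thesis
      using Suc.prems(2)[of b] \<open>a < b\<close> by (simp add: vwalk_def set_vwalk_arcs_snoc)
  qed
qed

lemma vpath_map_upt_layers:
  assumes "a < b" and disjoint: "disjoint_family_on V {a..<b}"
    and verts: "\<And>x. a \<le> x \<Longrightarrow> x < b \<Longrightarrow> V x \<subseteq> verts G"
    and arcs: "\<And>x. a \<le> x \<Longrightarrow> Suc x < b \<Longrightarrow> V x \<times> V (Suc x) \<subseteq> arcs_ends G"
    and mem: "\<And>x. a \<le> x \<Longrightarrow> x < b \<Longrightarrow> f x \<in> V x"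
  shows "vpath (map f [a..<b]) G"
proof -
  have "inj_on f {a..<b}"
  proof (rule inj_onI, rule ccontr)
    fix x y assume "x \<in> {a..<b}" "y \<in> {a..<b}" "f x = f y" "x \<noteq> y"
    then show False using mem[of x] mem[of y] disjoint_family_onD[OF disjoint, of x y] by auto
  qed
  moreover have "vwalk (map f [a..<b]) G"
  proof (rule vwalk_map_upt[OF \<open>a < b\<close>])
    show "f x \<in> verts G" if "a \<le> x" "x < b" for x
      using mem[OF that] verts[OF that] by blast
    show "(f x, f (Suc x)) \<in> arcs_ends G" if "a \<le> x" "Suc x < b" for x
      using mem[of x] mem[of "Suc x"] arcs[OF that] that by auto
  qed
  ultimately show ?thesis by (simp add: vpath_def distinct_map)
qed

lemma nonrepetitive_imp_disjnt_layers:
  fixes V :: "nat \<Rightarrow> 'v set"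
  assumes "nonrepetitive G \<phi>" and "r \<ge> 1"
    and "disjoint_family_on V {a..<a + 2 * r}"
    and "\<And>x. a \<le> x \<Longrightarrow> x < a + 2 * r \<Longrightarrow> V x \<subseteq> verts G"
    and "\<And>x. a \<le> x \<Longrightarrow> Suc x < a + 2 * r \<Longrightarrow> V x \<times> V (Suc x) \<subseteq> arcs_ends G"
  shows "\<exists>x\<in>{a..<a + r}. disjnt (\<phi> ` V x) (\<phi> ` V (x + r))"
proof (rule ccontr)
  assume "\<not> ?thesis"
  then have "\<forall>x\<in>{a..<a + r}. \<exists>u v. u \<in> V x \<and> v \<in> V (x + r) \<and> \<phi> u = \<phi> v"
    by (fastforce simp: disjnt_iff)
  then obtain u v where same_colour:
    "\<And>x. x \<in> {a..<a + r} \<Longrightarrow> u x \<in> V x \<and> v x \<in> V (x + r) \<and> \<phi> (u x) = \<phi> (v x)"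
    by metis
  define f where "f x = (if x < a + r then u x else v (x - r))" for x
  have f_mem: "f x \<in> V x" if "a \<le> x" "x < a + 2 * r" for x
  proof (cases "x < a + r")
    case True
    then show ?thesis using same_colour[of x] that by (simp add: f_def)
  next
    case False
    then have "x - r \<in> {a..<a + r}" "x - r + r = x" using that by auto
    then show ?thesis using same_colour[of "x - r"] False by (simp add: f_def)
  qed
  let ?p = "map f [a..<a + 2 * r]"
  have "vpath ?p G"
    using \<open>r \<ge> 1\<close> by (intro vpath_map_upt_layers[OF _ assms(3-5) f_mem]) simp_all
  moreover have "length ?p = 2 * r" by simp
  moreover have "\<phi> (?p ! i) = \<phi> (?p ! (r + i))" if "i < r" for i
    using same_colour[of "a + i"] that by (simp add: f_def add.assoc add.commute)
  ultimately show False
    using \<open>nonrepetitive G \<phi>\<close> \<open>r \<ge> 1\<close> unfolding nonrepetitive_def by blast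
qed

section \<open>Counting disjoint pairs in a sequence of sets\<close>

definition disjnt_shifts :: "(nat \<Rightarrow> 'c set) \<Rightarrow> nat \<Rightarrow> nat \<Rightarrow> nat set" where
  "disjnt_shifts P N r = {x. 1 \<le> x \<and> x + r \<le> N \<and> disjnt (P x) (P (x + r))}"

lemma finite_disjnt_shifts: "finite (disjnt_shifts P N r)"
  by (rule finite_subset[of _ "{..N}"]) (auto simp: disjnt_shifts_def)

lemma card_disjnt_shifts_ge:
  assumes "\<And>a. 1 \<le> a \<Longrightarrow> a + 2 * r \<le> Suc N \<Longrightarrow> \<exists>x\<in>{a..<a + r}. disjnt (P x) (P (x + r))"
  shows "N div r \<le> card (disjnt_shifts P N r) + 1"
proof -
  have "{..<N div r - 1} \<subseteq> (\<lambda>x. (x - 1) div r) ` disjnt_shifts P N r"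
  proof
    fix k assume "k \<in> {..<N div r - 1}"
    then have "k + 2 \<le> N div r" by simp
    then have "(k + 2) * r \<le> N div r * r" by (rule mult_le_mono1)
    also have "\<dots> \<le> N" by (rule div_times_less_eq_dividend)
    finally have window: "k * r + 1 + 2 * r \<le> Suc N" by (simp add: algebra_simps)
    then obtain x
      where in_window: "x \<in> {k * r + 1..<k * r + 1 + r}" and disjnt: "disjnt (P x) (P (x + r))"
      using assms[of "k * r + 1"] by auto
    from in_window have "(x - 1) div r = k" by (intro div_nat_eqI) (auto simp: algebra_simps)
    moreover have "x \<in> disjnt_shifts P N r"
      using in_window disjnt window by (auto simp: disjnt_shifts_def)
    ultimately show "k \<in> (\<lambda>x. (x - 1) div r) ` disjnt_shifts P N r" by blast
  qed
  from surj_card_le[OF finite_disjnt_shifts this] show ?thesis by simp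
qed

definition disjnt_odds :: "(nat \<Rightarrow> 'c set) \<Rightarrow> nat \<Rightarrow> nat \<Rightarrow> nat set" where
  "disjnt_odds P N q = {p \<in> {1..N}. odd p \<and> disjnt (P q) (P p)}"

lemma finite_disjnt_odds: "finite (disjnt_odds P N q)"
  by (simp add: disjnt_odds_def)

lemma sum_card_disjnt_shifts_le:
  assumes "finite R" and odd: "\<And>r. r \<in> R \<Longrightarrow> odd r"
  shows "(\<Sum>r\<in>R. card (disjnt_shifts P N r)) \<le>
    (\<Sum>q\<in>{q \<in> {1..N}. even q}. card (disjnt_odds P N q))"
proof -
  let ?S = "SIGMA r:R. disjnt_shifts P N r"
  let ?T = "SIGMA q:{q \<in> {1..N}. even q}. disjnt_odds P N q"
  let ?f = "\<lambda>(r, x). if even x then (x, x + r) else (x + r, x)"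
  have "inj_on ?f ?S"
    using odd by (auto simp: inj_on_def split: if_splits)
  moreover have "?f ` ?S \<subseteq> ?T"
    using odd by (intro image_subsetI) (auto simp: disjnt_shifts_def disjnt_odds_def disjnt_sym)
  ultimately have "card ?S \<le> card ?T" by (rule card_inj_on_le) (simp add: finite_disjnt_odds)
  then show ?thesis
    using \<open>finite R\<close> by (simp add: finite_disjnt_shifts finite_disjnt_odds)
qed

lemma ln_le_sum_arithmetic_progression:
  fixes d :: real
  assumes "d \<ge> 0"
  shows "ln (d * real m + 1) \<le> (\<Sum>k<m. d / (d * real k + 1))"
proof (induction m)
  case 0
  then show ?case by simp
next
  case (Suc m)
  have "ln (d * real (Suc m) + 1) - ln (d * real m + 1) \<le>
      (d * real (Suc m) + 1 - (d * real m + 1)) / (d * real m + 1)"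
    using assms by (intro ln_diff_le) (simp_all add: add_nonneg_pos)
  also have "\<dots> = d / (d * real m + 1)" by (simp add: algebra_simps)
  finally have "ln (d * real (Suc m) + 1) - ln (d * real m + 1) \<le> d / (d * real m + 1)" .
  then show ?case using Suc.IH by simp
qed

lemma sum_card_disjnt_shifts_ge:
  assumes windows: "\<And>a r. odd r \<Longrightarrow> 1 \<le> a \<Longrightarrow> a + 2 * r \<le> Suc N \<Longrightarrow>
      \<exists>x\<in>{a..<a + r}. disjnt (P x) (P (x + r))"
  shows "real N / 2 * ln (2 * real m + 1) \<le>
    real (\<Sum>k<m. card (disjnt_shifts P N (2 * k + 1))) + 2 * real m"
proof -
  have term_bound: "real N / 2 * (2 / (2 * real k + 1)) \<le>
      real (card (disjnt_shifts P N (2 * k + 1))) + 2" for k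
  proof -
    have "real N / 2 * (2 / (2 * real k + 1)) = real N / real (2 * k + 1)"
      by (simp add: add.commute)
    also have "\<dots> \<le> real (N div (2 * k + 1)) + 1"
      using floor_divide_of_nat_eq[of N "2 * k + 1", where 'a = real] by linarith
    also have "N div (2 * k + 1) \<le> card (disjnt_shifts P N (2 * k + 1)) + 1"
      by (intro card_disjnt_shifts_ge windows) auto
    finally show ?thesis by simp
  qed
  have "real N / 2 * ln (2 * real m + 1) \<le> real N / 2 * (\<Sum>k<m. 2 / (2 * real k + 1))"
    using ln_le_sum_arithmetic_progression[of 2 m] by (intro mult_left_mono) auto
  also have "\<dots> \<le> (\<Sum>k<m. real (card (disjnt_shifts P N (2 * k + 1))) + 2)"
    unfolding sum_distrib_left by (intro sum_mono term_bound)
  finally show ?thesis by (simp add: sum.distrib)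
qed

lemma card_even_atLeastAtMost: "card {q \<in> {1..2 * n}. even q} = n"
proof -
  have "{q \<in> {1..2 * n}. even q} = (*) 2 ` {1..n}" by (auto elim!: evenE)
  then show ?thesis by (simp add: card_image inj_on_def)
qed

lemma le_exp_if_card_disjnt_odds_less:
  fixes P :: "nat \<Rightarrow> 'c set"
  assumes windows: "\<And>a r. odd r \<Longrightarrow> 1 \<le> a \<Longrightarrow> a + 2 * r \<le> Suc (2 * n) \<Longrightarrow>
      \<exists>x\<in>{a..<a + r}. disjnt (P x) (P (x + r))"
    and few: "\<And>q. even q \<Longrightarrow> q \<in> {1..2 * n} \<Longrightarrow> card (disjnt_odds P (2 * n) q) < l"
  shows "real n \<le> exp (real l)"
proof (cases "n = 0")
  case False
  define m where "m = n div 2"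
  let ?shifts = "\<Sum>k<m. card (disjnt_shifts P (2 * n) (2 * k + 1))"
  let ?E = "{q \<in> {1..2 * n}. even q}"
  have "?shifts = (\<Sum>r\<in>(\<lambda>k. 2 * k + 1) ` {..<m}. card (disjnt_shifts P (2 * n) r))"
    by (simp add: sum.reindex inj_on_def)
  also have "\<dots> \<le> (\<Sum>q\<in>?E. card (disjnt_odds P (2 * n) q))"
    by (rule sum_card_disjnt_shifts_le) auto
  also have "\<dots> + card ?E = (\<Sum>q\<in>?E. Suc (card (disjnt_odds P (2 * n) q)))"
    by (rule sum_Suc[symmetric])
  also have "\<dots> \<le> (\<Sum>q\<in>?E. l)"
    using few by (intro sum_mono) (simp add: Suc_le_eq)
  finally have upper: "?shifts + n \<le> n * l"
    by (simp only: card_even_atLeastAtMost sum_constant of_nat_id)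
  have "real n * ln (real n) \<le> real n * ln (2 * real m + 1)"
    using False by (intro mult_left_mono) (auto simp: m_def)
  also have "\<dots> \<le> real ?shifts + 2 * real m"
    using sum_card_disjnt_shifts_ge[of "2 * n" P m, OF windows] by simp
  also have "\<dots> \<le> real (?shifts + n)" by (simp add: m_def)
  also have "\<dots> \<le> real (n * l)" using upper by (rule of_nat_mono)
  finally have "ln (real n) \<le> real l" using False by simp
  then have "exp (ln (real n)) \<le> exp (real l)" by simp
  then show ?thesis using False by simp
qed simp

section \<open>Lists defeating every colouring\<close>

lemma card_disjnt_le:
  assumes disjoint: "disjoint_family_on P A" and "finite C"
    and subset: "\<And>p. p \<in> A \<Longrightarrow> P p \<subseteq> C" and nonempty: "\<And>p. p \<in> A \<Longrightarrow> P p \<noteq> {}"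
  shows "card {p \<in> A. disjnt Q (P p)} \<le> card (C - Q)"
proof -
  obtain c where c_mem: "\<And>p. p \<in> A \<Longrightarrow> c p \<in> P p"
    using nonempty by (meson ex_in_conv)
  have "inj_on c {p \<in> A. disjnt Q (P p)}"
    using c_mem disjoint by (force simp: inj_on_def disjoint_family_on_def)
  moreover have "c ` {p \<in> A. disjnt Q (P p)} \<subseteq> C - Q"
    using c_mem subset by (force simp: disjnt_iff)
  ultimately show ?thesis using \<open>finite C\<close> by (intro card_inj_on_le) auto
qed

lemma card_Diff_transversal_less:
  assumes all_subsets: "{B. B \<subseteq> C \<and> card B = k} \<subseteq> L ` J"
    and transversal: "\<And>j. j \<in> J \<Longrightarrow> \<phi> j \<in> L j"
  shows "card (C - \<phi> ` J) < k"
proof (rule ccontr)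
  assume "\<not> ?thesis"
  then obtain B where "B \<subseteq> C - \<phi> ` J" "card B = k"
    using obtain_subset_with_card_n[of k "C - \<phi> ` J"] by auto
  moreover from this obtain j where "j \<in> J" "B = L j" using all_subsets by blast
  ultimately show False using transversal[of j] by blast
qed

definition layer :: "nat \<Rightarrow> nat \<Rightarrow> nat \<Rightarrow> vertex set" where
  "layer n l k = {v \<in> G_verts n l. lower_index v = k}"

lemma layer_odd: "odd k \<Longrightarrow> k \<in> {1..2 * n} \<Longrightarrow> layer n l k = {Single k}"
  by (auto simp: layer_def G_verts_def elim!: oddE intro!: exI[of _ "Suc (k div 2)"])
    presburger

lemma layer_even:
  "even k \<Longrightarrow> k \<in> {1..2 * n} \<Longrightarrow> layer n l k = Multi k ` {1..(l * n) choose l}"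
  by (auto simp: layer_def G_verts_def elim!: evenE) presburger

definition palette :: "nat \<Rightarrow> nat \<Rightarrow> (vertex \<Rightarrow> 'c) \<Rightarrow> nat \<Rightarrow> 'c set" where
  "palette n l \<phi> k = \<phi> ` layer n l k"

lemma nonrepetitive_imp_disjnt_palettes:
  assumes "nonrepetitive (with_proj (G_graph n l)) \<phi>" and "r \<ge> 1"
  shows "\<exists>x\<in>{a..<a + r}. disjnt (palette n l \<phi> x) (palette n l \<phi> (x + r))"
  unfolding palette_def
proof (rule nonrepetitive_imp_disjnt_layers[OF assms])
  show "disjoint_family_on (layer n l) {a..<a + 2 * r}"
    by (auto simp: disjoint_family_on_def layer_def)
  show "layer n l x \<subseteq> verts (with_proj (G_graph n l))" for x
    by (auto simp: layer_def G_graph_def)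
  show "layer n l x \<times> layer n l (Suc x) \<subseteq> arcs_ends (with_proj (G_graph n l))" for x
    by (auto simp: layer_def G_graph_def arcs_ends_def arc_to_ends_def)
qed

definition adversarial_lists :: "nat \<Rightarrow> nat \<Rightarrow> (vertex \<Rightarrow> nat set) \<Rightarrow> bool" where
  "adversarial_lists n l L \<longleftrightarrow>
     (\<forall>v\<in>G_verts n l. L v \<subseteq> {..<l * n} \<and> card (L v) = l) \<and>
     disjoint_family_on (\<lambda>p. L (Single p)) {p \<in> {1..2 * n}. odd p} \<and>
     (\<forall>q\<in>{1..2 * n}. even q \<longrightarrow> {B. B \<subseteq> {..<l * n} \<and> card B = l} \<subseteq> L ` layer n l q)"

lemma exists_adversarial_lists: "\<exists>L. adversarial_lists n l L"
proof -
  let ?S = "{B. B \<subseteq> {..<l * n} \<and> card B = l}"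
  have "card ?S = (l * n) choose l" by (simp add: n_subsets)
  moreover have "finite ?S" by simp
  ultimately obtain enum where enum: "enum ` {1..(l * n) choose l} = ?S"
    using ex_bij_betw_nat_finite_1[of ?S] by (auto simp: bij_betw_def)
  define block where "block i = {i * l..<i * l + l}" for i
  define L where "L v = (case v of Single p \<Rightarrow> block (p div 2) | Multi q j \<Rightarrow> enum j)" for v
  have card_block: "card (block i) = l" for i by (simp add: block_def)
  have block_subset: "block i \<subseteq> {..<l * n}" if "i < n" for i
  proof -
    have "Suc i * l \<le> n * l" using that by (intro mult_le_mono1) simp
    then show ?thesis by (auto simp: block_def algebra_simps)
  qed
  have block_div: "c div l = i" if "c \<in> block i" for c i
    using that by (intro div_nat_eqI) (auto simp: block_def algebra_simps)
  have "L v \<subseteq> {..<l * n} \<and> card (L v) = l" if "v \<in> G_verts n l" for v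
  proof (cases v)
    case (Single p)
    then have "p div 2 < n" using that by (auto simp: G_verts_def)
    then show ?thesis using Single block_subset by (simp add: L_def card_block)
  next
    case (Multi q j)
    then have "enum j \<in> ?S" using that enum by (auto simp: G_verts_def)
    then show ?thesis using Multi by (simp add: L_def)
  qed
  moreover have "disjoint_family_on (\<lambda>p. L (Single p)) {p \<in> {1..2 * n}. odd p}"
    by (auto simp: disjoint_family_on_def L_def dest!: block_div elim!: oddE)
  moreover have "?S \<subseteq> L ` layer n l q" if "even q" "q \<in> {1..2 * n}" for q
    using enum that by (simp add: layer_even L_def image_image)
  ultimately have "adversarial_lists n l L" by (simp add: adversarial_lists_def)
  then show ?thesis by blast
qed

lemma adversarial_lists_card_disjnt_odds_less:
  assumes adversarial: "adversarial_lists n l L"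
    and from_lists: "\<And>v. v \<in> G_verts n l \<Longrightarrow> \<phi> v \<in> L v"
    and "even q" "q \<in> {1..2 * n}"
  shows "card (disjnt_odds (palette n l \<phi>) (2 * n) q) < l"
proof -
  let ?P = "palette n l \<phi>"
  let ?O = "{p \<in> {1..2 * n}. odd p}"
  have palette_subset: "?P p \<subseteq> L (Single p)" if "p \<in> ?O" for p
  proof -
    have "layer n l p = {Single p}" using that by (simp add: layer_odd)
    moreover from this have "Single p \<in> G_verts n l" by (auto simp: layer_def)
    ultimately show ?thesis using from_lists by (simp add: palette_def)
  qed
  have "disjoint_family_on (\<lambda>p. L (Single p)) ?O"
    using adversarial by (simp add: adversarial_lists_def)
  then have "disjoint_family_on ?P ?O"
  proof (rule disjoint_family_on_bisimulation)
    fix p p' assume "p \<in> ?O" "p' \<in> ?O" "L (Single p) \<inter> L (Single p') = {}"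
    then show "?P p \<inter> ?P p' = {}" using palette_subset[of p] palette_subset[of p'] by blast
  qed
  moreover have "?P p \<subseteq> {..<l * n}" for p
    using adversarial from_lists by (force simp: adversarial_lists_def palette_def layer_def)
  moreover have "?P p \<noteq> {}" if "p \<in> ?O" for p
    using that by (simp add: palette_def layer_odd)
  ultimately have "card {p \<in> ?O. disjnt (?P q) (?P p)} \<le> card ({..<l * n} - ?P q)"
    by (intro card_disjnt_le) auto
  also have "\<dots> < l"
    unfolding palette_def
  proof (rule card_Diff_transversal_less)
    show "{B. B \<subseteq> {..<l * n} \<and> card B = l} \<subseteq> L ` layer n l q"
      using adversarial \<open>even q\<close> \<open>q \<in> {1..2 * n}\<close> by (simp add: adversarial_lists_def)
    show "\<phi> v \<in> L v" if "v \<in> layer n l q" for v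
      using from_lists that by (simp add: layer_def)
  qed
  finally show ?thesis by (simp only: disjnt_odds_def mem_Collect_eq conj_assoc)
qed

lemma nonrepetitively_choosable_G_graph_imp_le_exp:
  assumes "nonrepetitively_choosable (with_proj (G_graph n l)) l"
  shows "real n \<le> exp (real l)"
proof -
  obtain L where adversarial: "adversarial_lists n l L" using exists_adversarial_lists by blast
  then have "\<forall>v\<in>G_verts n l. finite (L v) \<and> l \<le> card (L v)"
    by (auto simp: adversarial_lists_def intro: finite_subset)
  then obtain \<phi> where nonrepetitive: "nonrepetitive (with_proj (G_graph n l)) \<phi>"
    and from_lists: "\<And>v. v \<in> G_verts n l \<Longrightarrow> \<phi> v \<in> L v"
    using assms by (auto simp: nonrepetitively_choosable_def G_graph_def)
  show ?thesis
  proof (rule le_exp_if_card_disjnt_odds_less)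
    show "\<exists>x\<in>{a..<a + r}. disjnt (palette n l \<phi> x) (palette n l \<phi> (x + r))" if "odd r" for a r
      using nonrepetitive odd_pos[OF that] by (intro nonrepetitive_imp_disjnt_palettes) simp_all
    show "card (disjnt_odds (palette n l \<phi>) (2 * n) q) < l" if "even q" "q \<in> {1..2 * n}" for q
      using adversarial from_lists that by (rule adversarial_lists_card_disjnt_odds_less)
  qed
qed

section \<open>The Thue choice number\<close>

lemma nonrepetitively_choosable_mono:
  assumes choosable: "nonrepetitively_choosable G k" and "k \<le> l"
  shows "nonrepetitively_choosable G l"
  unfolding nonrepetitively_choosable_def
proof (intro allI impI)
  fix L :: "'a \<Rightarrow> nat set"
  assume "\<forall>v\<in>verts G. finite (L v) \<and> l \<le> card (L v)"
  then have "\<forall>v\<in>verts G. finite (L v) \<and> k \<le> card (L v)" using \<open>k \<le> l\<close> by auto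
  with choosable show "\<exists>\<phi>. nonrepetitive G \<phi> \<and> (\<forall>v\<in>verts G. \<phi> v \<in> L v)"
    by (simp add: nonrepetitively_choosable_def)
qed

lemma nonrepetitively_choosable_thue_choice_number:
  assumes "finite (verts G)"
  shows "nonrepetitively_choosable G (thue_choice_number G)"
  unfolding thue_choice_number_def
  using nonrepetitively_choosable_card_verts[OF assms] by (rule LeastI)

theorem theorem3:
  fixes l n :: nat
  assumes "l \<ge> 1" and "real n > exp (real l + 2)"
  shows "thue_choice_number (with_proj (G_graph n l)) > l"
proof (rule ccontr)
  let ?G = "with_proj (G_graph n l)"
  assume "\<not> thue_choice_number ?G > l"
  moreover have "nonrepetitively_choosable ?G (thue_choice_number ?G)"
    by (rule nonrepetitively_choosable_thue_choice_number) (simp add: G_graph_def finite_G_verts)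
  ultimately have "nonrepetitively_choosable ?G l"
    by (auto intro: nonrepetitively_choosable_mono)
  then have "real n \<le> exp (real l)" by (rule nonrepetitively_choosable_G_graph_imp_le_exp)
  also have "\<dots> < exp (real l + 2)" by simp
  finally show False using assms(2) by simp
qed

end
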